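(* Let $\Omega\subset\mathbb{R}^2$ be a convex body (compact convex set with non-empty interior) with piecewise $C^1$ boundary which is axially symmetric, i.e. invariant under the reflection in some line. Then for every $h>0$, $\Omega$ has a unique solid angle center of height $h$.
   Context: $A_\Omega^{(h)}(x)=\int_\Omega \frac{h}{(|y-x|^2+h^2)^{3/2}}\,dy$ for $x\in\mathbb{R}^2$, $h>0$; a solid angle center of height $h$ is a point maximizing $A_\Omega^{(h)}$ over $\mathbb{R}^2$. *)

theory Defs
  imports "HOL-Analysis.Analysis"
begin

definition convex_body :: "(real^2) set \<Rightarrow> bool" where
  "convex_body \<Omega> \<longleftrightarrow> compact \<Omega> \<and> convex \<Omega> \<and> interior \<Omega> \<noteq> {}"

definition piecewise_C1_boundary :: "(real^2) set \<Rightarrow> bool" where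
  "piecewise_C1_boundary \<Omega> \<longleftrightarrow>
     (\<exists>g. valid_path g \<and> simple_path g \<and> pathfinish g = pathstart g \<and>
          path_image g = frontier \<Omega>)"

text \<open>Reflection in the line through p with unit direction u.\<close>
definition line_reflection :: "real^2 \<Rightarrow> real^2 \<Rightarrow> real^2 \<Rightarrow> real^2" where
  "line_reflection p u x = p + (2 * ((x - p) \<bullet> u)) *\<^sub>R u - (x - p)"

definition axially_symmetric :: "(real^2) set \<Rightarrow> bool" where
  "axially_symmetric \<Omega> \<longleftrightarrow>
     (\<exists>p u. norm u = 1 \<and> line_reflection p u ` \<Omega> = \<Omega>)"

definition solid_angle :: "(real^2) set \<Rightarrow> real \<Rightarrow> real^2 \<Rightarrow> real" where
  "solid_angle \<Omega> h x = integral \<Omega> (\<lambda>y. h / (norm (y - x) ^ 2 + h ^ 2) powr (3/2))"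

definition solid_angle_center :: "(real^2) set \<Rightarrow> real \<Rightarrow> real^2 \<Rightarrow> bool" where
  "solid_angle_center \<Omega> h c \<longleftrightarrow> (\<forall>x. solid_angle \<Omega> h x \<le> solid_angle \<Omega> h c)"

end

theory Submission
  imports Defs
begin

text \<open>Every maximizer lies on the axis, because a slice of the body orthogonal to the axis is an
  interval centered on it, and the potential of an interval decreases strictly when its center is left.
  On the axis, a slice of half-length a at signed distance r contributes, with v = sqrt (r^2 + h^2),
  f = 2 a / (v^2 sqrt (a^2 + v^2)), and f^(-1/2) is, up to a constant, a jointly convex function of
  (a, v), decreasing in a and increasing in v. As a is a concave function of the position of the slice,
  a one-dimensional Borell--Brascamp--Lieb argument (monotone transport of one slice density to the
  other, followed by the midpoint map) shows that at the midpoint of two points of the axis with equal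
  potential the potential is strictly larger.\<close>

section \<open>Monotone rearrangement on an interval\<close>

text \<open>On the axis the potential is positive and tends to 0 at infinity, so it cannot be
  concave. Comparing points of equal potential is enough for a unique maximizer, and it gives both
  slice densities the same mass over the same interval, so the transport T fixes the ends of that
  interval. With densities f, g at the two points and k at their midpoint, the map (s + T s) / 2 has
  derivative (1 + f/g) / 2, and the pointwise inequality needed is f <= k (1 + f/g) / 2, that is 1/k
  <= (1/f + 1/g) / 2. Convexity of 1/f would do; the power -1/2 is chosen because f is homogeneous
  of degree -2 in (a, v). Its power -1/2 then has degree 1, and joint convexity reduces to that of
  the one-variable function x (1 + x^2)^(1/4), where x = v/a. Strictness cannot come from a, which
  may be affine; it comes from v, a strictly convex function of the distance r because h > 0.
  Equality in every slice would force T to be a translation, which is incompatible with fixed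
  ends.\<close>

lemma strict_increase_of_DERIV:
  fixes f f' :: "real \<Rightarrow> real"
  assumes "c < d" "continuous_on {c..d} f"
    and der: "\<And>s. s \<in> {c<..<d} \<Longrightarrow> (f has_real_derivative f' s) (at s)"
    and nonneg: "\<And>s. s \<in> {c<..<d} \<Longrightarrow> 0 \<le> f' s"
    and p: "p \<in> {c<..<d}" "0 < f' p"
  shows "f c < f d"
proof -
  have mono: "f x \<le> f y" if "c \<le> x" "x \<le> y" "y \<le> d" for x y
  proof (cases "x = y")
    case False
    show ?thesis
    proof (rule DERIV_nonneg_imp_increasing_open[OF \<open>x \<le> y\<close>])
      fix z assume "x < z" "z < y"
      then show "\<exists>y. DERIV f z :> y \<and> 0 \<le> y" using der[of z] nonneg[of z] \<open>c \<le> x\<close> \<open>y \<le> d\<close> by auto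
    next
      show "continuous_on {x..y} f"
        using assms(2) that by (meson atLeastatMost_subset_iff continuous_on_subset)
    qed
  qed simp
  \<comment> \<open>The derivative need not be continuous: a positive value at the single point
    \<open>p\<close> gives a gain just to its right, and monotonicity carries this gain to both
    ends.\<close>
  obtain e where e: "0 < e" "\<And>k. 0 < k \<Longrightarrow> k < e \<Longrightarrow> f p < f (p + k)"
    using DERIV_pos_inc_right[OF der[OF p(1)] p(2)] by blast
  define k where "k = min (e/2) ((d - p)/2)"
  have k: "0 < k" "k < e" "p + k \<le> d" using e(1) p(1) by (auto simp: k_def min_def field_simps)
  have "f c \<le> f p" using p by (intro mono) auto
  also have "\<dots> < f (p + k)" using e k by blast
  also have "\<dots> \<le> f d" using p k by (intro mono) auto
  finally show ?thesis .
qed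

lemma indefinite_integral_DERIV:
  fixes f :: "real \<Rightarrow> real"
  assumes "f integrable_on {c..d}" "continuous_on {c<..<d} f" "s \<in> {c<..<d}"
  shows "((\<lambda>u. integral {c..u} f) has_real_derivative f s) (at s)"
proof -
  have cont: "continuous (at s) f"
    using assms by (simp add: continuous_on_eq_continuous_at)
  have "((\<lambda>u. integral {c..u} f) has_vector_derivative f s) (at s within ({c..d} - {}))"
    using assms cont by (intro integral_has_vector_derivative_continuous_at)
      (auto intro: continuous_at_imp_continuous_within)
  then have "((\<lambda>u. integral {c..u} f) has_vector_derivative f s) (at s within {c<..<d})"
    by (rule has_vector_derivative_within_subset) auto
  then show ?thesis
    using assms(3) by (simp add: has_real_derivative_iff_has_vector_derivative
      has_vector_derivative_def at_within_open[of s "{c<..<d}"])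
qed

text \<open>Continuity is asked only in the interior because the densities inherit it from a concave
  half-length, for which it is derived on an open interval.\<close>

lemma integral_strict_mono_open_interval:
  fixes f g :: "real \<Rightarrow> real"
  assumes "c < d" and f: "f integrable_on {c..d}" "continuous_on {c<..<d} f"
    and g: "g integrable_on {c..d}" "continuous_on {c<..<d} g"
    and less: "\<And>s. s \<in> {c<..<d} \<Longrightarrow> f s < g s"
  shows "integral {c..d} f < integral {c..d} g"
proof -
  have "integral {c..c} g - integral {c..c} f < integral {c..d} g - integral {c..d} f"
  proof (rule strict_increase_of_DERIV[where f = "\<lambda>u. integral {c..u} g - integral {c..u} f"
          and f' = "\<lambda>s. g s - f s"])
    show "continuous_on {c..d} (\<lambda>u. integral {c..u} g - integral {c..u} f)"
      by (intro continuous_intros indefinite_integral_continuous_1 f g)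
    show "((\<lambda>u. integral {c..u} g - integral {c..u} f) has_real_derivative g s - f s) (at s)"
      if "s \<in> {c<..<d}" for s
      by (rule DERIV_diff[OF indefinite_integral_DERIV[OF g that] indefinite_integral_DERIV[OF f that]])
    show "(c + d) / 2 \<in> {c<..<d}" using \<open>c < d\<close> by auto
    then show "0 < g ((c + d) / 2) - f ((c + d) / 2)" using less by simp
  qed (use less \<open>c < d\<close> in \<open>auto intro: less_imp_le\<close>)
  then show ?thesis by simp
qed

text \<open>With cumulative masses F and G, the map is T = G^(-1) o F. Equal total mass makes it
  send the interval to itself with fixed ends, and differentiating G (T s) = F s gives the quotient
  of densities.\<close>

lemma monotone_rearrangement:
  fixes f g :: "real \<Rightarrow> real"
  assumes "c < d" and f: "f integrable_on {c..d}" "continuous_on {c<..<d} f"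
    and g: "g integrable_on {c..d}" "continuous_on {c<..<d} g"
    and fpos: "\<And>s. s \<in> {c<..<d} \<Longrightarrow> 0 < f s" and gpos: "\<And>s. s \<in> {c<..<d} \<Longrightarrow> 0 < g s"
    and eq: "integral {c..d} f = integral {c..d} g"
  obtains T where "continuous_on {c..d} T" "T c = c" "T d = d"
    "\<And>s. s \<in> {c<..<d} \<Longrightarrow> T s \<in> {c<..<d}"
    "\<And>s. s \<in> {c<..<d} \<Longrightarrow> (T has_real_derivative f s / g (T s)) (at s)"
proof -
  define F where "F u = integral {c..u} f" for u
  define G where "G u = integral {c..u} g" for u
  have contF: "continuous_on {c..d} F" and contG: "continuous_on {c..d} G"
    unfolding F_def G_def by (intro indefinite_integral_continuous_1 f g)+
  have derF: "(F has_real_derivative f s) (at s)" and derG: "(G has_real_derivative g s) (at s)"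
    if "s \<in> {c<..<d}" for s
    unfolding F_def G_def using indefinite_integral_DERIV[OF f that] indefinite_integral_DERIV[OF g that]
    by simp_all
  have monoF: "F x < F y" if "c \<le> x" "x < y" "y \<le> d" for x y
    by (rule strict_increase_of_DERIV[where f' = f and p = "(x + y) / 2"])
      (use that derF fpos contF in \<open>auto intro: continuous_on_subset less_imp_le\<close>)
  have monoG: "G x < G y" if "c \<le> x" "x < y" "y \<le> d" for x y
    by (rule strict_increase_of_DERIV[where f' = g and p = "(x + y) / 2"])
      (use that derG gpos contG in \<open>auto intro: continuous_on_subset less_imp_le\<close>)
  have ends: "F c = 0" "G c = 0" "F d = G d" by (simp_all add: F_def G_def eq)
  have injG: "inj_on G {c..d}"
    by (rule linorder_inj_onI) (use monoG in \<open>force+\<close>)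
  have imG: "G ` {c..d} = {0..G d}"
  proof
    show "G ` {c..d} \<subseteq> {0..G d}"
      using monoG ends \<open>c < d\<close> by (force simp: less_eq_real_def)
    show "{0..G d} \<subseteq> G ` {c..d}"
      using IVT'[of G c _ d] ends contG \<open>c < d\<close> by fastforce
  qed
  define H where "H = inv_into {c..d} G"
  have HG: "H (G x) = x" if "x \<in> {c..d}" for x using that injG by (simp add: H_def)
  have GH: "G (H y) = y" "H y \<in> {c..d}" if "y \<in> {0..G d}" for y
    using that imG f_inv_into_f[of y G "{c..d}"] inv_into_into[of y G "{c..d}"]
    unfolding H_def by auto
  have Hin: "H y \<in> {c<..<d}" if "y \<in> {0<..<G d}" for y
    using GH[of y] that ends by (cases "H y = c"; cases "H y = d") auto
  have contH: "continuous_on {0..G d} H"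
    using continuous_on_inv[OF contG compact_Icc, of H] HG imG by auto
  have derH: "(H has_real_derivative inverse (g (H y))) (at y)" if y: "y \<in> {0<..<G d}" for y
  proof (rule DERIV_inverse_function[where f = G and a = 0 and b = "G d"])
    show "isCont H y" using contH y by (simp add: continuous_on_interior)
    show "(G has_real_derivative g (H y)) (at (H y))" using Hin[OF y] by (rule derG)
    show "g (H y) \<noteq> 0" using gpos[OF Hin[OF y]] by simp
  qed (use y GH in auto)
  have Fin: "F s \<in> {0<..<G d}" if "s \<in> {c<..<d}" for s
    using that monoF[of c s] monoF[of s d] ends by auto
  have Fin': "F s \<in> {0..G d}" if "s \<in> {c..d}" for s
    using that monoF[of c s] monoF[of s d] ends by (cases "s = c"; cases "s = d") auto
  show ?thesis
  proof (rule that[of "\<lambda>s. H (F s)"])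
    show "continuous_on {c..d} (\<lambda>s. H (F s))"
      by (rule continuous_on_compose2[OF contH contF]) (use Fin' in auto)
    show "H (F c) = c" "H (F d) = d" using ends HG[of c] HG[of d] \<open>c < d\<close> by auto
    fix s assume s: "s \<in> {c<..<d}"
    show "H (F s) \<in> {c<..<d}" using Hin[OF Fin[OF s]] .
    show "((\<lambda>s. H (F s)) has_real_derivative f s / g (H (F s))) (at s)"
      using DERIV_chain2[OF derH[OF Fin[OF s]] derF[OF s]] by (simp add: field_simps)
  qed
qed

text \<open>A one-dimensional Borell--Brascamp--Lieb inequality. Its hypotheses are what the monotone
  rearrangement of f into g needs after the substitution by the midpoint map.\<close>
lemma integral_less_midpoint:
  fixes f g k :: "real \<Rightarrow> real"
  assumes "c < d" and f: "f integrable_on {c..d}" "continuous_on {c<..<d} f"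
    and g: "g integrable_on {c..d}" "continuous_on {c<..<d} g"
    and k: "k integrable_on {c..d}" "continuous_on {c<..<d} k"
    and fpos: "\<And>s. s \<in> {c<..<d} \<Longrightarrow> 0 < f s" and gpos: "\<And>s. s \<in> {c<..<d} \<Longrightarrow> 0 < g s"
    and eq: "integral {c..d} f = integral {c..d} g"
    and mid: "\<And>s r. s \<in> {c<..<d} \<Longrightarrow> r \<in> {c<..<d} \<Longrightarrow>
        f s \<le> k ((s + r) / 2) * ((1 + f s / g r) / 2)"
    and mid_strict: "\<And>s r. s \<in> {c<..<d} \<Longrightarrow> r \<in> {c<..<d} \<Longrightarrow> r - s \<noteq> \<tau> \<Longrightarrow>
        f s < k ((s + r) / 2) * ((1 + f s / g r) / 2)"
    and "\<tau> \<noteq> 0"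
  shows "integral {c..d} f < integral {c..d} k"
proof -
  obtain T where T: "continuous_on {c..d} T" "T c = c" "T d = d"
    and Tin: "\<And>s. s \<in> {c<..<d} \<Longrightarrow> T s \<in> {c<..<d}"
    and derT: "\<And>s. s \<in> {c<..<d} \<Longrightarrow> (T has_real_derivative f s / g (T s)) (at s)"
    using monotone_rearrangement[OF \<open>c < d\<close> f g fpos gpos eq] by blast
  define m where "m s = (s + T s) / 2" for s
  have min: "m s \<in> {c<..<d}" if "s \<in> {c<..<d}" for s
    using Tin[OF that] that by (auto simp: m_def)
  have min': "m s \<in> {c..d}" if "s \<in> {c..d}" for s
    using min[of s] that T by (cases "s = c"; cases "s = d") (auto simp: m_def)
  define K where "K u = integral {c..u} k" for u
  define D where "D s = k (m s) * ((1 + f s / g (T s)) / 2) - f s" for s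
  \<comment> \<open>A point where equality is excluded: so close to the end towards which
    \<open>\<tau>\<close> points that p + \<open>\<tau>\<close> leaves the interval, while
    \<open>T p\<close> stays inside. The midpoint of the interval in the \<open>max\<close> and
    \<open>min\<close> below keeps \<open>p\<close> itself inside when \<open>\<tau>\<close> is
    large.\<close>
  obtain p where p: "p \<in> {c<..<d}" "T p - p \<noteq> \<tau>"
  proof (cases "\<tau> > 0")
    case True
    define p where "p = max ((c + d) / 2) (d - \<tau> / 2)"
    have "(c + d) / 2 \<le> p" "d - \<tau> / 2 \<le> p" "p < d"
      using \<open>c < d\<close> True by (auto simp: p_def)
    then have "p \<in> {c<..<d}" "p + \<tau> > d" using \<open>c < d\<close> True by auto
    then show ?thesis using Tin[of p] by (intro that[of p]) auto
  next
    case False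
    define p where "p = min ((c + d) / 2) (c - \<tau> / 2)"
    have "p \<le> (c + d) / 2" "p \<le> c - \<tau> / 2" "c < p"
      unfolding p_def min_less_iff_conj using \<open>c < d\<close> False \<open>\<tau> \<noteq> 0\<close> by (simp_all add: min_def)
    then have "p \<in> {c<..<d}" "p + \<tau> < c" using \<open>c < d\<close> False \<open>\<tau> \<noteq> 0\<close> by auto
    then show ?thesis using Tin[of p] by (intro that[of p]) auto
  qed
  \<comment> \<open>Substitution by \<open>m\<close> without a change-of-variables theorem: since
    \<open>m\<close> fixes \<open>c\<close> and \<open>d\<close>, the total increment of
    \<open>K (m s)\<close> is the whole integral of \<open>k\<close>, and \<open>mid\<close> says
    that the difference has derivative at least 0.\<close>
  have "K (m c) - integral {c..c} f < K (m d) - integral {c..d} f"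
  proof (rule strict_increase_of_DERIV[where f = "\<lambda>s. K (m s) - integral {c..s} f" and f' = D])
    have "continuous_on {c..d} m" unfolding m_def by (intro continuous_intros T) auto
    moreover have "continuous_on {c..d} K"
      unfolding K_def by (intro indefinite_integral_continuous_1 k)
    ultimately have "continuous_on {c..d} (\<lambda>s. K (m s))"
      using min' by (auto intro: continuous_on_compose2)
    then show "continuous_on {c..d} (\<lambda>s. K (m s) - integral {c..s} f)"
      by (intro continuous_intros indefinite_integral_continuous_1 f)
    show "((\<lambda>s. K (m s) - integral {c..s} f) has_real_derivative D s) (at s)"
      if s: "s \<in> {c<..<d}" for s
    proof -
      have "(m has_real_derivative (1 + f s / g (T s)) / 2) (at s)"
        unfolding m_def using derT[OF s] by (auto intro!: derivative_eq_intros)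
      moreover have "(K has_real_derivative k (m s)) (at (m s))"
        unfolding K_def by (rule indefinite_integral_DERIV[OF k min[OF s]])
      ultimately have "((\<lambda>s. K (m s)) has_real_derivative k (m s) * ((1 + f s / g (T s)) / 2)) (at s)"
        by (rule DERIV_chain2[rotated])
      then show ?thesis unfolding D_def by (rule DERIV_diff[OF _ indefinite_integral_DERIV[OF f s]])
    qed
    show "0 \<le> D s" if "s \<in> {c<..<d}" for s
      using mid[OF that Tin[OF that]] by (simp add: D_def m_def)
    show "0 < D p" using mid_strict[OF p(1) Tin[OF p(1)] p(2)] by (simp add: D_def m_def)
  qed (use \<open>c < d\<close> p in auto)
  then show ?thesis using T by (simp add: K_def m_def)
qed

section \<open>The potential of a slice\<close>

lemma DERIV_over_sqrt:
  fixes w x :: real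
  assumes "0 < w"
  shows "((\<lambda>x. x / sqrt (x\<^sup>2 + w)) has_real_derivative w / (x\<^sup>2 + w) powr (3/2)) (at x)"
proof -
  define q where "q = x\<^sup>2 + w"
  have q: "0 < q" using assms by (simp add: q_def add_nonneg_pos)
  have sq: "sqrt q ^ 2 = q" using q by simp
  have p: "q powr (3/2) = q * sqrt q"
    using q powr_add[of q 1 "1/2"] by (simp add: powr_half_sqrt)
  have "((\<lambda>x. x / sqrt (x\<^sup>2 + w)) has_real_derivative
      (1 * sqrt q - x * (inverse (sqrt q) / 2 * (2 * x))) / (sqrt q * sqrt q)) (at x)"
    using q unfolding q_def by (auto intro!: derivative_eq_intros)
  moreover have "(1 * S - x * (inverse S / 2 * (2 * x))) / (S * S) = w / (q * S)"
    if "0 < S" "S * S = q" for S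
  proof -
    have "1 * S - x * (inverse S / 2 * (2 * x)) = w / S"
      using that by (simp add: q_def power2_eq_square field_simps)
    then show ?thesis unfolding that(2) using that by simp
  qed
  from this[of "sqrt q"] have
    "(1 * sqrt q - x * (inverse (sqrt q) / 2 * (2 * x))) / (sqrt q * sqrt q) = w / q powr (3/2)"
    unfolding p using q sq by (simp add: power2_eq_square)
  ultimately show ?thesis by (simp add: q_def)
qed

text \<open>The kernel integrated along one slice: \<open>w\<close> stands for r^2 + h^2 with r the
  distance along the axis, \<open>a\<close> for the half-length of the slice, and \<open>x0\<close>
  for the distance of the evaluation point from the axis.\<close>

lemma integral_inverse_distance_cubed:
  fixes a w x0 :: real
  assumes "0 < w" "0 \<le> a"
  shows "((\<lambda>x. 1 / ((x - x0)\<^sup>2 + w) powr (3/2)) has_integral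
    ((a - x0) / sqrt ((a - x0)\<^sup>2 + w) + (a + x0) / sqrt ((a + x0)\<^sup>2 + w)) / w) {-a..a}"
proof -
  have "((\<lambda>x. 1 / ((x - x0)\<^sup>2 + w) powr (3/2)) has_integral
      (a - x0) / sqrt ((a - x0)\<^sup>2 + w) / w - (- a - x0) / sqrt ((- a - x0)\<^sup>2 + w) / w) {-a..a}"
  proof (rule fundamental_theorem_of_calculus)
    fix x
    have "((\<lambda>x. (x - x0) / sqrt ((x - x0)\<^sup>2 + w)) has_real_derivative
        w / ((x - x0)\<^sup>2 + w) powr (3/2) * 1) (at x)"
      by (rule DERIV_chain2[OF DERIV_over_sqrt[OF assms(1)]]) (auto intro!: derivative_eq_intros)
    from DERIV_cdivide[OF this, of w]
    have "((\<lambda>x. (x - x0) / sqrt ((x - x0)\<^sup>2 + w) / w) has_real_derivative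
        1 / ((x - x0)\<^sup>2 + w) powr (3/2)) (at x)"
      using assms by simp
    then show "((\<lambda>x. (x - x0) / sqrt ((x - x0)\<^sup>2 + w) / w) has_vector_derivative
        1 / ((x - x0)\<^sup>2 + w) powr (3/2)) (at x within {-a..a})"
      by (simp add: has_real_derivative_iff_has_vector_derivative has_vector_derivative_at_within)
  qed (use assms in simp)
  moreover have "(- a - x0)\<^sup>2 = (a + x0)\<^sup>2" by (simp add: power2_eq_square algebra_simps)
  ultimately show ?thesis by (simp add: diff_divide_distrib add_divide_distrib algebra_simps)
qed

text \<open>The derivative in the shift is the kernel at the far end a + y minus the kernel at the
  near end a - y, negative for y > 0 because the kernel decreases with distance. Evenness in the
  shift covers the other sign.\<close>

lemma over_sqrt_shift_less:
  fixes a w x :: real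
  assumes "0 < w" "0 < a" "x \<noteq> 0"
  shows "(a - x) / sqrt ((a - x)\<^sup>2 + w) + (a + x) / sqrt ((a + x)\<^sup>2 + w) < 2 * (a / sqrt (a\<^sup>2 + w))"
proof -
  define f where "f x = (a - x) / sqrt ((a - x)\<^sup>2 + w) + (a + x) / sqrt ((a + x)\<^sup>2 + w)" for x
  have der: "(f has_real_derivative
      w / ((a + y)\<^sup>2 + w) powr (3/2) - w / ((a - y)\<^sup>2 + w) powr (3/2)) (at y)" for y
  proof -
    have "((\<lambda>y. (a - y) / sqrt ((a - y)\<^sup>2 + w)) has_real_derivative
        w / ((a - y)\<^sup>2 + w) powr (3/2) * (-1)) (at y)"
      by (rule DERIV_chain2[OF DERIV_over_sqrt[OF assms(1)]]) (auto intro!: derivative_eq_intros)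
    moreover have "((\<lambda>y. (a + y) / sqrt ((a + y)\<^sup>2 + w)) has_real_derivative
        w / ((a + y)\<^sup>2 + w) powr (3/2) * 1) (at y)"
      by (rule DERIV_chain2[OF DERIV_over_sqrt[OF assms(1)]]) (auto intro!: derivative_eq_intros)
    ultimately show ?thesis unfolding f_def by (rule DERIV_cong[OF DERIV_add]) simp
  qed
  have "f z < f 0" if "0 < z" for z
  proof (rule DERIV_neg_imp_decreasing_open[OF that])
    fix y assume y: "0 < y" "y < z"
    have "(a - y)\<^sup>2 < (a + y)\<^sup>2" using y assms by (simp add: power2_eq_square algebra_simps)
    then have "((a - y)\<^sup>2 + w) powr (3/2) < ((a + y)\<^sup>2 + w) powr (3/2)"
      using assms by (intro powr_less_mono2) auto
    moreover have "0 < ((a - y)\<^sup>2 + w) powr (3/2)"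
      using assms by (smt (verit) powr_gt_zero zero_le_power2)
    ultimately have "w / ((a + y)\<^sup>2 + w) powr (3/2) - w / ((a - y)\<^sup>2 + w) powr (3/2) < 0"
      using assms by (simp add: frac_less2)
    then show "\<exists>D. (f has_real_derivative D) (at y) \<and> D < 0" using der by blast
  next
    show "continuous_on {0..z} f"
      by (intro continuous_at_imp_continuous_on ballI DERIV_isCont[OF der])
  qed
  then have "f \<bar>x\<bar> < f 0" using assms by simp
  moreover have "f \<bar>x\<bar> = f x" by (auto simp: f_def abs_if)
  ultimately show ?thesis by (simp add: f_def)
qed

section \<open>The convex gauge of a slice and its midpoint inequalities\<close>

definition gauge_profile :: "real \<Rightarrow> real" where
  "gauge_profile r = r * (1 + r\<^sup>2) powr (1/4)"

lemma convex_on_gauge_profile: "convex_on {0<..} gauge_profile"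
proof (rule f''_ge0_imp_convex[where f' = "\<lambda>r. (1 + r\<^sup>2) powr (-3/4) * (1 + 3 / 2 * r\<^sup>2)"
      and f'' = "\<lambda>r. (1 + r\<^sup>2) powr (-7/4) * (r * (3 / 2 + 3 / 4 * r\<^sup>2))"])
  fix r :: real assume "r \<in> {0<..}"
  then have r: "0 < r" by simp
  define q where "q = 1 + r\<^sup>2"
  have q: "0 < q" by (simp add: q_def add_pos_nonneg)
  \<comment> \<open>Lowering the exponents to a common -3/4 and then -7/4 lets each derivative
    factor into a positive power of \<open>q\<close> times a polynomial with nonnegative
    coefficients.\<close>
  have e1: "q powr (1/4) = q powr (-3/4) * q" using powr_add[of q "-3/4" 1] q by simp
  have e2: "q powr (-3/4) = q powr (-7/4) * q" using powr_add[of q "-7/4" 1] q by simp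
  have der: "((\<lambda>r. (1 + r\<^sup>2) powr e) has_real_derivative e * q powr (e - 1) * (2 * r)) (at r)" for e
    unfolding q_def
    by (rule DERIV_chain2[OF has_real_derivative_powr])
      (use q in \<open>auto simp: q_def intro!: derivative_eq_intros\<close>)
  have "(gauge_profile has_real_derivative 1 * q powr (1/4) + 1/4 * q powr (1/4 - 1) * (2 * r) * r) (at r)"
    unfolding gauge_profile_def q_def by (rule DERIV_mult[OF DERIV_ident der[unfolded q_def]])
  moreover have "1 * q powr (1/4) + 1/4 * q powr (1/4 - 1) * (2 * r) * r = q powr (-3/4) * (1 + 3 / 2 * r\<^sup>2)"
    using e1 by (simp add: q_def power2_eq_square algebra_simps)
  ultimately show "(gauge_profile has_real_derivative (1 + r\<^sup>2) powr (-3/4) * (1 + 3 / 2 * r\<^sup>2)) (at r)"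
    by (simp add: q_def)
  have "((\<lambda>r. 1 + 3 / 2 * r\<^sup>2) has_real_derivative 3 * r) (at r)"
    by (auto intro!: derivative_eq_intros)
  from DERIV_mult[OF der[of "-3/4"] this]
  have "((\<lambda>r. (1 + r\<^sup>2) powr (-3/4) * (1 + 3 / 2 * r\<^sup>2)) has_real_derivative
      (-3/4) * q powr (-3/4 - 1) * (2 * r) * (1 + 3 / 2 * r\<^sup>2) + 3 * r * q powr (-3/4)) (at r)"
    by (simp only: q_def)
  moreover have "(-3/4) * q powr (-3/4 - 1) * (2 * r) * (1 + 3 / 2 * r\<^sup>2) + 3 * r * q powr (-3/4)
      = q powr (-7/4) * (r * (3 / 2 + 3 / 4 * r\<^sup>2))"
  proof -
    have "(-3/4) * P * (2 * r) * (1 + 3 / 2 * r\<^sup>2) + 3 * r * (P * q) = P * (r * (3 / 2 + 3 / 4 * r\<^sup>2))" for P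
      by (simp add: q_def power2_eq_square field_simps)
    from this[of "q powr (-7/4)"] show ?thesis unfolding e2 by simp
  qed
  ultimately show "((\<lambda>r. (1 + r\<^sup>2) powr (-3/4) * (1 + 3 / 2 * r\<^sup>2)) has_real_derivative
      (1 + r\<^sup>2) powr (-7/4) * (r * (3 / 2 + 3 / 4 * r\<^sup>2))) (at r)"
    by (simp add: q_def)
  show "0 \<le> (1 + r\<^sup>2) powr (-7/4) * (r * (3 / 2 + 3 / 4 * r\<^sup>2))" using r by simp
qed simp

text \<open>Up to the factor sqrt 2, the power -1/2 of the potential of a slice with half-length
  \<open>a\<close> at distance \<open>v\<close> from the elevated point. The perspective form is the
  one that yields joint convexity.\<close>

definition slice_gauge :: "real \<Rightarrow> real \<Rightarrow> real" where
  "slice_gauge a v = a * gauge_profile (v / a)"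

lemma slice_gauge_pos: "0 < a \<Longrightarrow> 0 < v \<Longrightarrow> 0 < slice_gauge a v"
  using powr_gt_zero[of "1 + (v / a)\<^sup>2" "1/4"] add_pos_nonneg[of 1 "(v / a)\<^sup>2"]
  unfolding slice_gauge_def gauge_profile_def by (intro mult_pos_pos) auto

text \<open>The form that shows monotonicity: \<open>a\<close> occurs only as a denominator, and
  \<open>v\<close> only in increasing positions.\<close>

lemma slice_gauge_eq: "0 < a \<Longrightarrow> slice_gauge a v = v * (1 + (v / a)\<^sup>2) powr (1/4)"
  unfolding slice_gauge_def gauge_profile_def mult.assoc[symmetric] by simp

lemma slice_gauge_mono:
  assumes "0 < b" "b \<le> a" "0 < v" "v \<le> w"
  shows "slice_gauge a v \<le> slice_gauge b w"
proof -
  have "(v / a)\<^sup>2 \<le> (w / b)\<^sup>2" using assms by (intro power_mono frac_le) auto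
  then have "(1 + (v / a)\<^sup>2) powr (1/4) \<le> (1 + (w / b)\<^sup>2) powr (1/4)"
    by (intro powr_mono2) auto
  then show ?thesis using assms unfolding slice_gauge_eq[OF assms(1)] slice_gauge_eq[OF less_le_trans[OF assms(1,2)]]
    by (intro mult_mono) auto
qed

text \<open>Strictness in \<open>v\<close> alone is enough, since only the distances, not the
  half-lengths, are known to be strictly convex.\<close>

lemma slice_gauge_strict_mono:
  assumes "0 < b" "b \<le> a" "0 < v" "v < w"
  shows "slice_gauge a v < slice_gauge b w"
proof -
  have "(v / a)\<^sup>2 \<le> (w / b)\<^sup>2" using assms by (intro power_mono frac_le) auto
  then have "(1 + (v / a)\<^sup>2) powr (1/4) \<le> (1 + (w / b)\<^sup>2) powr (1/4)"
    by (intro powr_mono2) auto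
  moreover have "0 < (1 + (v / a)\<^sup>2) powr (1/4)" by (smt (verit) powr_gt_zero zero_le_power2)
  ultimately show ?thesis using assms unfolding slice_gauge_eq[OF assms(1)] slice_gauge_eq[OF less_le_trans[OF assms(1,2)]]
    by (intro mult_less_le_imp_less) auto
qed

text \<open>The gauge is the perspective of a convex function, hence jointly convex.\<close>
lemma slice_gauge_midpoint:
  assumes "0 < a" "0 < b" "0 < v" "0 < w"
  shows "slice_gauge ((a + b) / 2) ((v + w) / 2) \<le> (slice_gauge a v + slice_gauge b w) / 2"
proof -
  \<comment> \<open>The weights proportional to the half-lengths turn the combination of v/a and w/b
    into (v + w) / (a + b), the ratio at the midpoint.\<close>
  define t where "t = b / (a + b)"
  have t: "0 \<le> t" "t \<le> 1" "1 - t = a / (a + b)" using assms by (auto simp: t_def field_simps)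
  have "gauge_profile ((1 - t) *\<^sub>R (v / a) + t *\<^sub>R (w / b))
      \<le> (1 - t) * gauge_profile (v / a) + t * gauge_profile (w / b)"
    using assms t by (intro convex_onD[OF convex_on_gauge_profile]) auto
  moreover have "(1 - t) *\<^sub>R (v / a) + t *\<^sub>R (w / b) = (v + w) / (a + b)"
    unfolding t(3) using assms by (simp add: t_def add_divide_distrib)
  ultimately have "(a + b) * gauge_profile ((v + w) / (a + b))
      \<le> (a + b) * (a / (a + b) * gauge_profile (v / a) + b / (a + b) * gauge_profile (w / b))"
    using assms by (intro mult_left_mono) (auto simp: t_def t(3)[unfolded t_def])
  also have "\<dots> = a * gauge_profile (v / a) + b * gauge_profile (w / b)"
    using assms by (simp add: distrib_left)
  finally have "(a + b) / 2 * gauge_profile ((v + w) / (a + b))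
      \<le> (a * gauge_profile (v / a) + b * gauge_profile (w / b)) / 2" by simp
  moreover have "x / 2 / (y / 2) = x / y" for x y :: real by simp
  ultimately show ?thesis by (simp only: slice_gauge_def)
qed

definition slice_potential :: "real \<Rightarrow> real \<Rightarrow> real" where
  "slice_potential a w = 2 * (a / sqrt (a\<^sup>2 + w)) / w"

lemma slice_potential_eq:
  assumes "0 < a" "0 < v"
  shows "slice_potential a (v\<^sup>2) = 2 / (slice_gauge a v)\<^sup>2"
proof -
  have "0 < 1 + (v / a)\<^sup>2" by (simp add: add_pos_nonneg)
  then have "((1 + (v / a)\<^sup>2) powr (1/4))\<^sup>2 = sqrt (1 + (v / a)\<^sup>2)"
    by (simp add: powr_power powr_half_sqrt)
  also have "\<dots> = sqrt (a\<^sup>2 + v\<^sup>2) / a"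
  proof -
    have "1 + (v / a)\<^sup>2 = (a\<^sup>2 + v\<^sup>2) / a\<^sup>2" using assms by (simp add: field_simps)
    then show ?thesis using assms by (simp add: real_sqrt_divide)
  qed
  finally have "(slice_gauge a v)\<^sup>2 = v\<^sup>2 * (sqrt (a\<^sup>2 + v\<^sup>2) / a)"
    using assms by (simp add: slice_gauge_eq power_mult_distrib)
  then show ?thesis using assms by (simp add: slice_potential_def)
qed

text \<open>Here \<open>p\<close>, \<open>q\<close>, \<open>m\<close> are gauge values, 2/p^2 and so
  on the potentials, and the last factor is the derivative of the midpoint map. Everything reduces
  to 2 m^2 <= p^2 + q^2, which follows from the arithmetic mean being at most the quadratic
  mean.\<close>

lemma inverse_square_midpoint:
  fixes p q m :: real
  assumes "0 < p" "0 < q" "0 < m"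
  shows "m \<le> (p + q) / 2 \<Longrightarrow> 2 / p\<^sup>2 \<le> 2 / m\<^sup>2 * ((1 + 2 / p\<^sup>2 / (2 / q\<^sup>2)) / 2)"
    and "m < (p + q) / 2 \<Longrightarrow> 2 / p\<^sup>2 < 2 / m\<^sup>2 * ((1 + 2 / p\<^sup>2 / (2 / q\<^sup>2)) / 2)"
proof -
  have eq: "2 / m\<^sup>2 * ((1 + 2 / p\<^sup>2 / (2 / q\<^sup>2)) / 2) = (p\<^sup>2 + q\<^sup>2) / (m\<^sup>2 * p\<^sup>2)"
    using assms by (simp add: field_simps)
  have eq2: "2 / p\<^sup>2 = (2 * m\<^sup>2) / (m\<^sup>2 * p\<^sup>2)" using assms by (simp add: field_simps)
  have qm: "2 * ((p + q) / 2)\<^sup>2 \<le> p\<^sup>2 + q\<^sup>2"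
    using zero_le_power2[of "p - q"] by (simp add: power2_eq_square field_simps)
  show "2 / p\<^sup>2 \<le> 2 / m\<^sup>2 * ((1 + 2 / p\<^sup>2 / (2 / q\<^sup>2)) / 2)" if "m \<le> (p + q) / 2"
  proof -
    have "m\<^sup>2 \<le> ((p + q) / 2)\<^sup>2" using that assms by (intro power_mono) auto
    then have "2 * m\<^sup>2 \<le> p\<^sup>2 + q\<^sup>2" using qm by linarith
    then show ?thesis unfolding eq using assms by (subst eq2, intro divide_right_mono) auto
  qed
  show "2 / p\<^sup>2 < 2 / m\<^sup>2 * ((1 + 2 / p\<^sup>2 / (2 / q\<^sup>2)) / 2)" if "m < (p + q) / 2"
  proof -
    have "m\<^sup>2 < ((p + q) / 2)\<^sup>2" using that assms by (intro power_strict_mono) auto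
    then have "2 * m\<^sup>2 < p\<^sup>2 + q\<^sup>2" using qm by linarith
    then show ?thesis unfolding eq using assms by (subst eq2, intro divide_strict_right_mono) auto
  qed
qed

text \<open>This is the triangle inequality for the plane vectors (x, h) and (y, h). Since h > 0,
  they are parallel only if they coincide.\<close>

lemma sqrt_sum_squares_midpoint:
  fixes x y h :: real
  assumes "0 < h"
  shows "sqrt (((x + y) / 2)\<^sup>2 + h\<^sup>2) \<le> (sqrt (x\<^sup>2 + h\<^sup>2) + sqrt (y\<^sup>2 + h\<^sup>2)) / 2"
    and "x \<noteq> y \<Longrightarrow> sqrt (((x + y) / 2)\<^sup>2 + h\<^sup>2) < (sqrt (x\<^sup>2 + h\<^sup>2) + sqrt (y\<^sup>2 + h\<^sup>2)) / 2"
proof -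
  define v w where "v = sqrt (x\<^sup>2 + h\<^sup>2)" and "w = sqrt (y\<^sup>2 + h\<^sup>2)"
  have vw: "0 \<le> v" "0 \<le> w" "v\<^sup>2 = x\<^sup>2 + h\<^sup>2" "w\<^sup>2 = y\<^sup>2 + h\<^sup>2"
    by (auto simp: v_def w_def)
  \<comment> \<open>Lagrange's identity: the last summand is the defect in the Cauchy-Schwarz
    inequality, and it is positive when \<open>x\<close> and \<open>y\<close> differ.\<close>
  have id: "(v * w)\<^sup>2 = (x * y + h\<^sup>2)\<^sup>2 + h\<^sup>2 * (x - y)\<^sup>2"
    unfolding power_mult_distrib vw by (simp add: power2_eq_square algebra_simps)
  have sq: "((v + w) / 2)\<^sup>2 = ((x + y) / 2)\<^sup>2 + h\<^sup>2 + (v * w - (x * y + h\<^sup>2)) / 2"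
    using vw(3,4) by (simp add: power2_eq_square field_simps)
  have "x * y + h\<^sup>2 \<le> v * w"
  proof (rule power2_le_imp_le)
    show "(x * y + h\<^sup>2)\<^sup>2 \<le> (v * w)\<^sup>2" unfolding id by simp
    show "0 \<le> v * w" using vw by simp
  qed
  then have "((x + y) / 2)\<^sup>2 + h\<^sup>2 \<le> ((v + w) / 2)\<^sup>2" unfolding sq by simp
  then show "sqrt (((x + y) / 2)\<^sup>2 + h\<^sup>2) \<le> (sqrt (x\<^sup>2 + h\<^sup>2) + sqrt (y\<^sup>2 + h\<^sup>2)) / 2"
    unfolding v_def[symmetric] w_def[symmetric] using vw by (intro real_le_lsqrt) auto
  assume "x \<noteq> y"
  have "x * y + h\<^sup>2 < v * w"
  proof (rule power2_less_imp_less)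
    show "(x * y + h\<^sup>2)\<^sup>2 < (v * w)\<^sup>2" unfolding id using \<open>x \<noteq> y\<close> assms by simp
    show "0 \<le> v * w" using vw by simp
  qed
  then have "((x + y) / 2)\<^sup>2 + h\<^sup>2 < ((v + w) / 2)\<^sup>2" unfolding sq by simp
  then show "sqrt (((x + y) / 2)\<^sup>2 + h\<^sup>2) < (sqrt (x\<^sup>2 + h\<^sup>2) + sqrt (y\<^sup>2 + h\<^sup>2)) / 2"
    unfolding v_def[symmetric] w_def[symmetric] using vw by (intro real_less_lsqrt) auto
qed

text \<open>Supplies the hypotheses \<open>mid\<close> and \<open>mid_strict\<close> of
  \<open>integral_less_midpoint\<close>. Concavity of the half-length enters as the lower bound on
  \<open>m\<close>; \<open>x\<close> and \<open>y\<close> are the signed distances of the two slices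
  from their respective evaluation points.\<close>

lemma slice_potential_midpoint:
  fixes a b m x y h :: real
  assumes "0 < h" "0 < a" "0 < b" "(a + b) / 2 \<le> m"
  defines "f \<equiv> slice_potential a (x\<^sup>2 + h\<^sup>2)" and "g \<equiv> slice_potential b (y\<^sup>2 + h\<^sup>2)"
    and "k \<equiv> slice_potential m (((x + y) / 2)\<^sup>2 + h\<^sup>2)"
  shows "f \<le> k * ((1 + f / g) / 2)" and "x \<noteq> y \<Longrightarrow> f < k * ((1 + f / g) / 2)"
proof -
  define u v w where "u = sqrt (x\<^sup>2 + h\<^sup>2)" and "v = sqrt (y\<^sup>2 + h\<^sup>2)"
    and "w = sqrt (((x + y) / 2)\<^sup>2 + h\<^sup>2)"
  have pos: "0 < u" "0 < v" "0 < w" "0 < m" using assms by (auto simp: u_def v_def w_def add_nonneg_pos)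
  have "u\<^sup>2 = x\<^sup>2 + h\<^sup>2" "v\<^sup>2 = y\<^sup>2 + h\<^sup>2" "w\<^sup>2 = ((x + y) / 2)\<^sup>2 + h\<^sup>2"
    by (auto simp: u_def v_def w_def)
  then have eqs: "f = 2 / (slice_gauge a u)\<^sup>2" "g = 2 / (slice_gauge b v)\<^sup>2" "k = 2 / (slice_gauge m w)\<^sup>2"
    using slice_potential_eq[of a u] slice_potential_eq[of b v] slice_potential_eq[of m w] pos assms
    by (simp_all add: f_def g_def k_def)
  have gpos: "0 < slice_gauge a u" "0 < slice_gauge b v" "0 < slice_gauge m w"
    using pos assms by (auto intro: slice_gauge_pos)
  have mid: "slice_gauge ((a + b) / 2) ((u + v) / 2) \<le> (slice_gauge a u + slice_gauge b v) / 2"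
    using assms pos by (intro slice_gauge_midpoint) auto
  have "w \<le> (u + v) / 2"
    unfolding u_def v_def w_def using assms by (intro sqrt_sum_squares_midpoint)
  then have "slice_gauge m w \<le> slice_gauge ((a + b) / 2) ((u + v) / 2)"
    using assms pos by (intro slice_gauge_mono) auto
  then show "f \<le> k * ((1 + f / g) / 2)"
    unfolding eqs using mid gpos by (intro inverse_square_midpoint) auto
  assume "x \<noteq> y"
  then have "w < (u + v) / 2"
    unfolding u_def v_def w_def using assms by (intro sqrt_sum_squares_midpoint)
  then have "slice_gauge m w < slice_gauge ((a + b) / 2) ((u + v) / 2)"
    using assms pos by (intro slice_gauge_strict_mono) auto
  then show "f < k * ((1 + f / g) / 2)"
    unfolding eqs using mid gpos by (intro inverse_square_midpoint) auto
qed

section \<open>Coordinates along the axis\<close>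

text \<open>Stated for push-forward measures so that integrals can be transferred by
  \<open>integral_distr\<close>. It suffices to test open boxes: their preimages are images under
  the inverse transformation, which preserves measure.\<close>

lemma distr_lborel_orthogonal_transformation:
  fixes T :: "real^'n::{finite,wellorder} \<Rightarrow> real^'n::_"
  assumes T: "orthogonal_transformation T"
  shows "distr lborel borel T = lborel"
proof (rule sym, rule lborel_eqI)
  have cont: "continuous_on UNIV T"
    using T by (simp add: orthogonal_transformation_linear linear_continuous_on linear_linear)
  then have meas: "T \<in> borel_measurable lborel" by (simp add: borel_measurable_continuous_onI)
  fix l u :: "(real, 'n) vec" assume le: "\<And>b. b \<in> Basis \<Longrightarrow> l \<bullet> b \<le> u \<bullet> b"
  have bij: "bij T" using T by (rule orthogonal_transformation_bij)
  have op: "open (T -` box l u)" by (rule open_vimage[OF open_box cont])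
  have eq: "T -` box l u = inv T ` box l u" using bij by (simp add: bij_vimage_eq_inv_image)
  have inv: "orthogonal_transformation (inv T)" using T by (rule orthogonal_transformation_inv)
  have lm: "inv T ` box l u \<in> lmeasurable" by (rule measurable_orthogonal_image[OF inv]) simp
  have "emeasure (distr lborel borel T) (box l u) = emeasure lborel (T -` box l u)"
    using meas by (subst emeasure_distr) auto
  also have "\<dots> = emeasure lebesgue (inv T ` box l u)"
    using op unfolding eq by (simp add: emeasure_completion)
  also have "\<dots> = ennreal (measure lebesgue (inv T ` box l u))"
    by (rule emeasure_eq_measure2[OF lm])
  also have "measure lebesgue (inv T ` box l u) = measure lebesgue (box l u)"
    by (rule measure_orthogonal_image[OF inv]) simp
  also have "\<dots> = (\<Prod>b\<in>Basis. (u - l) \<bullet> b)"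
    using le by simp
  finally show "emeasure (distr lborel borel T) (box l u) = (\<Prod>b\<in>Basis. (u - l) \<bullet> b)" .
qed simp

lemma Basis_real2: "(Basis :: (real^2) set) = {axis 1 1, axis 2 1}"
  by (auto simp: Basis_vec_def UNIV_2)

text \<open>The passage from \<open>real^2\<close> to pairs, where Fubini's theorem can cut the body
  into slices. The preimage of a box is a box with the same sides.\<close>

lemma distr_lborel_pair_vec:
  "distr (lborel :: (real \<times> real) measure) borel (\<lambda>z. fst z *\<^sub>R axis 1 1 + snd z *\<^sub>R axis 2 1 :: real^2) = lborel"
  (is "distr _ _ ?e = _")
proof (rule sym, rule lborel_eqI)
  have meas: "?e \<in> borel_measurable lborel"
    by (simp, intro borel_measurable_continuous_onI continuous_intros)
  fix l u :: "real^2" assume le: "\<And>b. b \<in> Basis \<Longrightarrow> l \<bullet> b \<le> u \<bullet> b"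
  then have le': "l$1 \<le> u$1" "l$2 \<le> u$2"
    using le[of "axis 1 1"] le[of "axis 2 1"] by (simp_all add: Basis_real2 inner_axis)
  have nth: "axis 1 (1::real) $ (2::2) = 0" "axis 2 (1::real) $ (1::2) = 0"
    by (simp_all add: axis_def)
  have inner: "w \<bullet> axis i 1 = w $ i" for w :: "real^2" and i by (simp add: inner_axis)
  have vim: "?e -` box l u = box (l$1, l$2) (u$1, u$2)"
    unfolding box_def Basis_real2 Basis_prod_def vimage_def by (auto simp: inner nth)
  have "emeasure (distr lborel borel ?e) (box l u) = emeasure lborel (box (l$1, l$2) (u$1, u$2))"
    using meas by (subst emeasure_distr) (auto simp: vim)
  also have "\<dots> = (\<Prod>b\<in>Basis. ((u$1, u$2) - (l$1, l$2)) \<bullet> b)"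
    using le' by (intro emeasure_lborel_box) (auto simp: Basis_prod_def)
  also have "(\<Prod>b\<in>Basis. ((u$1, u$2) - (l$1, l$2)) \<bullet> b) = (u$1 - l$1) * (u$2 - l$2)"
    by (simp add: Basis_prod_def)
  also have "\<dots> = (\<Prod>b\<in>Basis. (u - l) \<bullet> b)"
    by (simp add: Basis_real2 inner_axis axis_eq_axis)
  finally show "emeasure (distr lborel borel ?e) (box l u) = (\<Prod>b\<in>Basis. (u - l) \<bullet> b)" .
qed simp

section \<open>Slices of a convex body symmetric in the second coordinate\<close>

lemma slice_interval:
  fixes D :: "(real \<times> real) set"
  assumes "compact D" "convex D" "(s, y) \<in> D" and sym: "\<And>s x. (s, x) \<in> D \<Longrightarrow> (s, - x) \<in> D"
  shows "{x. (s, x) \<in> D} = {- Sup {x. (s, x) \<in> D}..Sup {x. (s, x) \<in> D}}"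
    and "(s, Sup {x. (s, x) \<in> D}) \<in> D"
proof -
  let ?S = "{x. (s, x) \<in> D}"
  let ?b = "Sup ?S"
  have "?S = Pair s -` D" by auto
  moreover have "closed (Pair s -` D)"
    using \<open>compact D\<close> by (intro closed_vimage compact_imp_closed continuous_intros)
  moreover have "?S = snd ` (D \<inter> {s} \<times> UNIV)" by force
  moreover have "bounded (snd ` (D \<inter> {s} \<times> UNIV))"
    using \<open>compact D\<close> by (intro bounded_snd bounded_Int disjI1 compact_imp_bounded)
  ultimately have "closed ?S" "bdd_above ?S" by (simp_all add: bounded_imp_bdd_above)
  then have b: "?b \<in> ?S" "\<And>x. x \<in> ?S \<Longrightarrow> x \<le> ?b"
    proof -
    have "?S \<noteq> {}" using \<open>(s, y) \<in> D\<close> by blast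
    then show "?b \<in> ?S" using \<open>closed ?S\<close> \<open>bdd_above ?S\<close> by (intro closed_contains_Sup)
    show "x \<le> ?b" if "x \<in> ?S" for x using that \<open>bdd_above ?S\<close> by (rule cSup_upper)
  qed
  then show bD: "(s, ?b) \<in> D" by simp
  have "convex ?S"
  proof (rule convexI)
    fix x z u v :: real assume "x \<in> ?S" "z \<in> ?S" and uv: "0 \<le> u" "0 \<le> v" "u + v = 1"
    then have "u *\<^sub>R (s, x) + v *\<^sub>R (s, z) \<in> D" using \<open>convex D\<close> by (intro convexD) auto
    moreover have "u * s + v * s = s" using uv by (metis distrib_right mult_1)
    ultimately show "u *\<^sub>R x + v *\<^sub>R z \<in> ?S" by simp
  qed
  moreover have "- ?b \<in> ?S" using sym[OF bD] by simp
  ultimately have "closed_segment (- ?b) ?b \<subseteq> ?S"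
    using b(1) by (intro closed_segment_subset)
  then have "{- ?b..?b} \<subseteq> ?S"
    by (cases "- ?b \<le> ?b") (simp_all only: closed_segment_eq_real_ivl if_True atLeastatMost_empty not_le empty_subsetI)
  moreover have "?S \<subseteq> {- ?b..?b}"
  proof
    fix x assume x: "x \<in> ?S"
    then have "- x \<in> ?S" using sym by simp
    with b(2)[OF x] b(2)[OF this] show "x \<in> {- ?b..?b}" by simp
  qed
  ultimately show "?S = {- ?b..?b}" by (rule subset_antisym[rotated])
qed

lemma symmetric_convex_slices:
  fixes D :: "(real \<times> real) set"
  assumes D: "compact D" "convex D" "interior D \<noteq> {}"
    and sym: "\<And>s x. (s, x) \<in> D \<Longrightarrow> (s, - x) \<in> D"
  obtains c d :: real and a :: "real \<Rightarrow> real" where "c < d" "concave_on {c<..<d} a"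
    "\<And>s. s \<in> {c<..<d} \<Longrightarrow> 0 < a s"
    "\<And>s. s \<in> {c<..<d} \<Longrightarrow> {x. (s, x) \<in> D} = {- a s..a s}"
    "\<And>s x. (s, x) \<in> D \<Longrightarrow> s \<in> {c..d}"
proof -
  define a where "a s = Sup {x. (s, x) \<in> D}" for s
  have a: "{x. (s, x) \<in> D} = {- a s..a s}" "(s, a s) \<in> D" if "(s, y) \<in> D" for s y
    unfolding a_def using slice_interval[OF D(1,2) that sym] by auto
  have comb: "((1 - t) * s + t * r, (1 - t) * x + t * y) \<in> D"
    if "(s, x) \<in> D" "(r, y) \<in> D" "0 \<le> t" "t \<le> 1" for s r x y t
    using convexD_alt[OF D(2) that] by simp
  obtain z e where "0 < e" and e: "cball z e \<subseteq> D"
    using D(3) by (metis all_not_in_conv mem_interior_cball)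
  obtain s0 x0 where z: "z = (s0, x0)" by (cases z)
  have inD: "(s, x) \<in> D" if "\<bar>s - s0\<bar> \<le> e / 2" "\<bar>x - x0\<bar> \<le> e / 2" for s x
  proof -
    have "dist (s0, x0) (s, x) \<le> \<bar>s - s0\<bar> + \<bar>x - x0\<bar>"
      using sqrt_sum_squares_le_sum_abs[of "dist s0 s" "dist x0 x"]
      by (simp add: dist_Pair_Pair dist_real_def abs_minus_commute)
    then show ?thesis using that e z by (auto simp: mem_cball)
  qed
  \<comment> \<open>The center of the ball may lie on the axis; moving away from the axis by e/2
    gives a point of the body that certainly does not.\<close>
  define x1 where "x1 = (if x0 \<ge> 0 then x0 + e / 2 else x0 - e / 2)"
  have x1: "(s0, x1) \<in> D" "x1 \<noteq> 0" using \<open>0 < e\<close> by (auto simp: x1_def intro!: inD)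
  then have x1pos: "(s0, \<bar>x1\<bar>) \<in> D" "0 < \<bar>x1\<bar>" using sym by (auto simp: abs_if)
  have "compact (fst ` D)"
    using D(1) by (intro compact_continuous_image continuous_intros)
  moreover have "convex (fst ` D)" by (rule convex_linear_image[OF linear_fst D(2)])
  ultimately have "connected (fst ` D) \<and> compact (fst ` D)" by (simp add: convex_connected)
  then obtain c d where cd: "fst ` D = {c..d}" unfolding connected_compact_interval_1 by blast
  have ends: "\<exists>y. (s, y) \<in> D" if "s \<in> {c..d}" for s
    using that unfolding cd[symmetric] by force
  have out: "s \<in> {c..d}" if "(s, x) \<in> D" for s x
    using that unfolding cd[symmetric] by force
  have "s0 - e / 2 \<in> {c..d}" "s0 + e / 2 \<in> {c..d}"
    using \<open>0 < e\<close> by (intro out[of _ x0] inD; simp)+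
  then have s0: "c < s0" "s0 < d" using \<open>0 < e\<close> by auto
  \<comment> \<open>The midpoint of any point of the slice and its mirror image.\<close>
  have zero: "(s, 0) \<in> D" if s: "s \<in> {c..d}" for s
  proof -
    obtain y where "(s, y) \<in> D" using ends s by blast
    from comb[OF this sym[OF this], of "1/2"] show ?thesis by simp
  qed
  have pos: "0 < a s" if s: "s \<in> {c<..<d}" for s
  proof -
    \<comment> \<open>\<open>r\<close> is the end of the projection on the same side of
      \<open>s0\<close> as \<open>s\<close>. The segment from (s0, |x1|) to (r, 0) lies in the body
      and passes over \<open>s\<close> at a positive height, because \<open>s\<close> is not the end
      \<open>r\<close>.\<close>
    obtain r where r: "r \<in> {c..d}" "r \<noteq> s" "s \<in> closed_segment s0 r"
    proof (cases "s \<le> s0")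
      case True
      then show ?thesis using that[of c] s by (auto simp: closed_segment_eq_real_ivl)
    next
      case False
      then show ?thesis using that[of d] s by (auto simp: closed_segment_eq_real_ivl)
    qed
    then obtain t where t: "0 \<le> t" "t \<le> 1" "s = (1 - t) * s0 + t * r"
      by (auto simp: closed_segment_def)
    with r have "t \<noteq> 1" by auto
    have "(s, (1 - t) * \<bar>x1\<bar>) \<in> D" using comb[OF x1pos(1) zero[OF r(1)], of t] t by simp
    with a(1)[OF this] have "(1 - t) * \<bar>x1\<bar> \<le> a s" by auto
    moreover have "0 < (1 - t) * \<bar>x1\<bar>" using t \<open>t \<noteq> 1\<close> x1pos(2) by simp
    ultimately show ?thesis by simp
  qed
  have "concave_on {c<..<d} a"
  proof -
    have "(1 - t) * a s + t * a r \<le> a ((1 - t) * s + t * r)"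
      if "0 < t" "t < 1" "s \<in> {c<..<d}" "r \<in> {c<..<d}" for t s r
    proof -
      have "(s, a s) \<in> D" "(r, a r) \<in> D" using that a(2)[OF zero] by auto
      from comb[OF this, of t] have "((1 - t) * s + t * r, (1 - t) * a s + t * a r) \<in> D"
        using that by simp
      with a(1)[OF this] show ?thesis by auto
    qed
    then show ?thesis
      unfolding concave_on_def by (intro convex_onI) (simp_all add: algebra_simps)
  qed
  moreover have "{x. (s, x) \<in> D} = {- a s..a s}" if "s \<in> {c<..<d}" for s
    by (rule a(1)[OF zero]) (use that in simp)
  moreover have "c < d" using s0 by simp
  ultimately show ?thesis using that[of c d a] pos out by blast
qed

text \<open>Fubini's theorem followed by the closed form of the integral along each slice. Outside
  the projection of the body the slices are empty.\<close>

lemma has_integral_slice_potentials: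
  fixes D :: "(real \<times> real) set" and a :: "real \<Rightarrow> real"
  assumes "compact D" "0 < h"
    and apos: "\<And>s. s \<in> {c<..<d} \<Longrightarrow> 0 < a s"
    and slice: "\<And>s. s \<in> {c<..<d} \<Longrightarrow> {x. (s, x) \<in> D} = {- a s..a s}"
    and out: "\<And>s x. (s, x) \<in> D \<Longrightarrow> s \<in> {c..d}"
  shows "((\<lambda>s. ((a s - \<xi>) / sqrt ((a s - \<xi>)\<^sup>2 + ((s - t)\<^sup>2 + h\<^sup>2))
        + (a s + \<xi>) / sqrt ((a s + \<xi>)\<^sup>2 + ((s - t)\<^sup>2 + h\<^sup>2))) / ((s - t)\<^sup>2 + h\<^sup>2))
      has_integral
        (LINT z|lborel. indicator D z *\<^sub>R (1 / ((snd z - \<xi>)\<^sup>2 + ((fst z - t)\<^sup>2 + h\<^sup>2)) powr (3/2)))) {c..d}"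
proof -
  define k where "k z = 1 / ((snd z - \<xi>)\<^sup>2 + ((fst z - t)\<^sup>2 + h\<^sup>2)) powr (3/2)" for z :: "real \<times> real"
  define f where "f z = indicator D z *\<^sub>R k z" for z
  define q where "q s = (LINT x|lborel. f (s, x))" for s
  define v where "v s = ((a s - \<xi>) / sqrt ((a s - \<xi>)\<^sup>2 + ((s - t)\<^sup>2 + h\<^sup>2))
        + (a s + \<xi>) / sqrt ((a s + \<xi>)\<^sup>2 + ((s - t)\<^sup>2 + h\<^sup>2))) / ((s - t)\<^sup>2 + h\<^sup>2)" for s
  have w: "0 < (s - t)\<^sup>2 + h\<^sup>2" for s using \<open>0 < h\<close> by (simp add: add_nonneg_pos)
  have base: "0 < (x - \<xi>)\<^sup>2 + ((s - t)\<^sup>2 + h\<^sup>2)" for s x using w[of s] by (simp add: add_nonneg_pos)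
  have cont: "continuous_on S k" for S
    unfolding k_def using base by (intro continuous_intros) (auto simp: less_imp_neq[symmetric])
  have "integrable lborel f"
    unfolding f_def by (rule borel_integrable_compact[OF \<open>compact D\<close> cont])
  then have intf: "integrable (lborel \<Otimes>\<^sub>M lborel) f" by (simp add: lborel_prod)
  have "integrable lborel q"
    unfolding q_def by (rule lborel_pair.integrable_fst'[OF intf])
  moreover have "(LINT s|lborel. q s) = (LINT z|lborel. f z)"
    unfolding q_def using lborel_pair.integral_fst'[OF intf] by (simp add: lborel_prod)
  ultimately have q: "(q has_integral (LINT z|lborel. f z)) UNIV"
    using has_integral_integral_lborel[of q] by simp
  have qout: "q s = 0" if "s \<notin> {c..d}" for s
  proof -
    have "(s, x) \<notin> D" for x using out that by blast
    then show ?thesis by (simp add: q_def f_def)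
  qed
  have qin: "q s = v s" if s: "s \<in> {c<..<d}" for s
  proof -
    have eq: "f (s, x) = indicator {- a s..a s} x *\<^sub>R k (s, x)" for x
      using slice[OF s] by (auto simp: f_def indicator_def)
    have "continuous_on {- a s..a s} (\<lambda>x. k (s, x))"
      by (rule continuous_on_compose2[OF cont[of UNIV]]) (auto intro!: continuous_intros)
    then have "integrable lborel (\<lambda>x. f (s, x))"
      unfolding eq by (intro borel_integrable_compact) auto
    then have "((\<lambda>x. f (s, x)) has_integral q s) UNIV"
      unfolding q_def by (rule has_integral_integral_lborel)
    moreover have "(\<lambda>x. f (s, x)) = (\<lambda>x. if x \<in> {- a s..a s} then k (s, x) else 0)"
      by (auto simp: eq fun_eq_iff)
    ultimately have "((\<lambda>x. k (s, x)) has_integral q s) {- a s..a s}"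
      using has_integral_restrict_UNIV[of "{- a s..a s}" "\<lambda>x. k (s, x)" "q s"] by simp
    moreover have "((\<lambda>x. k (s, x)) has_integral v s) {- a s..a s}"
      using integral_inverse_distance_cubed[OF w[of s], of "a s" \<xi>] apos[OF s]
      by (simp add: k_def v_def)
    ultimately show ?thesis by (rule has_integral_unique)
  qed
  have "q = (\<lambda>s. if s \<in> {c..d} then q s else 0)" using qout by auto
  with q have "(q has_integral (LINT z|lborel. f z)) {c..d}"
    using has_integral_restrict_UNIV[of "{c..d}" q] by simp
  \<comment> \<open>At the two ends the closed form is not established, since slices are described
    only over the open interval; two points do not affect the integral.\<close>
  then have "(v has_integral (LINT z|lborel. f z)) {c..d}"
    by (rule has_integral_spike_finite[of "{c, d}", rotated 2]) (use qin in auto)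
  then show ?thesis unfolding v_def f_def k_def .
qed

section \<open>The potential of a symmetric convex body\<close>

text \<open>The solid angle in axis coordinates without its factor \<open>h\<close>:
  \<open>t\<close> is the position along the axis, \<open>\<xi>\<close> the displacement across
  it.\<close>

definition potential :: "(real \<times> real) set \<Rightarrow> real \<Rightarrow> real \<Rightarrow> real \<Rightarrow> real" where
  "potential D h t \<xi> = (LINT z|lborel. indicator D z *\<^sub>R
     (1 / ((snd z - \<xi>)\<^sup>2 + ((fst z - t)\<^sup>2 + h\<^sup>2)) powr (3/2)))"

lemma potential_comparisons:
  fixes D :: "(real \<times> real) set"
  assumes D: "compact D" "convex D" "interior D \<noteq> {}"
    and sym: "\<And>s x. (s, x) \<in> D \<Longrightarrow> (s, - x) \<in> D" and "0 < h"
  shows potential_off_axis: "\<xi> \<noteq> 0 \<Longrightarrow> potential D h t \<xi> < potential D h t 0"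
    and potential_midpoint: "t \<noteq> t' \<Longrightarrow> potential D h t 0 = potential D h t' 0 \<Longrightarrow>
      potential D h t 0 < potential D h ((t + t') / 2) 0"
proof -
  obtain c d :: real and a :: "real \<Rightarrow> real" where "c < d" and conc: "concave_on {c<..<d} a"
    and apos: "\<And>s. s \<in> {c<..<d} \<Longrightarrow> 0 < a s"
    and slice: "\<And>s. s \<in> {c<..<d} \<Longrightarrow> {x. (s, x) \<in> D} = {- a s..a s}"
    and out: "\<And>s x. (s, x) \<in> D \<Longrightarrow> s \<in> {c..d}"
    using symmetric_convex_slices[OF D sym] by metis
  have "continuous_on {c<..<d} (\<lambda>s. - a s)"
    using conc by (intro convex_on_continuous) (auto simp: concave_on_def)
  then have conta: "continuous_on {c<..<d} a" using continuous_on_minus by fastforce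
  have w: "0 < (s - t)\<^sup>2 + h\<^sup>2" for s t using \<open>0 < h\<close> by (simp add: add_nonneg_pos)
  have pos: "0 < x\<^sup>2 + ((s - t)\<^sup>2 + h\<^sup>2)" for x s t using w[of s t] by (simp add: add_nonneg_pos)
  define v where "v t \<xi> s = ((a s - \<xi>) / sqrt ((a s - \<xi>)\<^sup>2 + ((s - t)\<^sup>2 + h\<^sup>2))
        + (a s + \<xi>) / sqrt ((a s + \<xi>)\<^sup>2 + ((s - t)\<^sup>2 + h\<^sup>2))) / ((s - t)\<^sup>2 + h\<^sup>2)" for t \<xi> s
  have int: "(v t \<xi> has_integral potential D h t \<xi>) {c..d}" for t \<xi>
    unfolding v_def potential_def
    by (rule has_integral_slice_potentials[OF D(1) \<open>0 < h\<close>]) (fact apos slice out)+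
  have vint: "v t \<xi> integrable_on {c..d}" "integral {c..d} (v t \<xi>) = potential D h t \<xi>" for t \<xi>
    using int[of t \<xi>] by (auto simp: has_integral_integrable integral_unique)
  have contv: "continuous_on {c<..<d} (v t \<xi>)" for t \<xi>
    unfolding v_def using w pos
    by (intro continuous_intros conta) (auto simp: less_imp_neq[symmetric])
  have v0: "v t 0 s = slice_potential (a s) ((s - t)\<^sup>2 + h\<^sup>2)" for t s
    by (simp add: v_def slice_potential_def)
  show "potential D h t \<xi> < potential D h t 0" if "\<xi> \<noteq> 0"
    unfolding vint(2)[symmetric]
  proof (rule integral_strict_mono_open_interval[OF \<open>c < d\<close> vint(1) contv vint(1) contv])
    show "v t \<xi> s < v t 0 s" if "s \<in> {c<..<d}" for s
      unfolding v0 slice_potential_def unfolding v_def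
      using over_sqrt_shift_less[OF w apos[OF that] \<open>\<xi> \<noteq> 0\<close>] w[of s t]
      by (intro divide_strict_right_mono) auto
  qed
  assume "t \<noteq> t'" and eq: "potential D h t 0 = potential D h t' 0"
  have mid: "(a s + a r) / 2 \<le> a ((s + r) / 2)" if "s \<in> {c<..<d}" "r \<in> {c<..<d}" for s r
    using concave_onD[OF conc, of "1/2" s r] that by (simp add: add_divide_distrib)
  have vpos: "0 < v t 0 s" if "s \<in> {c<..<d}" for t s
    unfolding v0 slice_potential_def
    using apos[OF that] w[of s t] pos[of "a s" s t] by simp
  \<comment> \<open>The axial distance from the midpoint slice to the midpoint of the two evaluation
    points is the mean of the two axial distances.\<close>
  have shift: "(s + r) / 2 - (t + t') / 2 = ((s - t) + (r - t')) / 2" for s r by (simp add: field_simps)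
  show "potential D h t 0 < potential D h ((t + t') / 2) 0"
    unfolding vint(2)[symmetric]
  proof (rule integral_less_midpoint[OF \<open>c < d\<close> vint(1) contv vint(1) contv vint(1) contv
        vpos vpos])
    show "integral {c..d} (v t 0) = integral {c..d} (v t' 0)" using eq by (simp add: vint)
    show "v t 0 s \<le> v ((t + t') / 2) 0 ((s + r) / 2) * ((1 + v t 0 s / v t' 0 r) / 2)"
      if "s \<in> {c<..<d}" "r \<in> {c<..<d}" for s r
      unfolding v0 shift using that by (intro slice_potential_midpoint \<open>0 < h\<close> apos mid)
    \<comment> \<open>The exceptional shift is t' - t: r - s differs from it exactly when the axial
      distances s - t and r - t' differ, which is when the midpoint inequality is strict.\<close>
    show "v t 0 s < v ((t + t') / 2) 0 ((s + r) / 2) * ((1 + v t 0 s / v t' 0 r) / 2)"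
      if "s \<in> {c<..<d}" "r \<in> {c<..<d}" "r - s \<noteq> t' - t" for s r
      unfolding v0 shift using that by (intro slice_potential_midpoint \<open>0 < h\<close> apos mid) auto
    show "t' - t \<noteq> 0" using \<open>t \<noteq> t'\<close> by simp
  qed
qed

text \<open>An orthogonal map sends the first basis vector to \<open>u\<close>, and \<open>n\<close>
  is its value at the second. The coordinate map is then the identification of pairs with vectors,
  followed by this map and a translation, each preserving Lebesgue measure.\<close>

lemma axis_frame:
  fixes p u :: "real^2"
  assumes "norm u = 1"
  obtains n :: "real^2" where "norm n = 1" "u \<bullet> n = 0"
    "surj (\<lambda>z. p + (fst z *\<^sub>R u + snd z *\<^sub>R n))"
    "distr (lborel :: (real \<times> real) measure) borel (\<lambda>z. p + (fst z *\<^sub>R u + snd z *\<^sub>R n)) = lborel"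
proof -
  obtain T :: "real^2 \<Rightarrow> real^2" where T: "orthogonal_transformation T" "T (axis 1 1) = u"
    using orthogonal_transformation_exists_1[of "axis 1 1" u] assms by auto
  define n where "n = T (axis 2 1)"
  let ?e = "\<lambda>z :: real \<times> real. fst z *\<^sub>R axis 1 1 + snd z *\<^sub>R axis 2 1 :: real^2"
  let ?f = "\<lambda>z :: real \<times> real. p + (fst z *\<^sub>R u + snd z *\<^sub>R n)"
  have lin: "linear T" using T(1) by (rule orthogonal_transformation_linear)
  have Te: "T (?e z) = fst z *\<^sub>R u + snd z *\<^sub>R n" for z
    using lin T(2) by (simp add: linear_add linear_cmul n_def)
  have "norm n = 1" unfolding n_def using T(1) by (simp add: orthogonal_transformation_norm)
  moreover have "u \<bullet> n = 0"
  proof -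
    have "u \<bullet> n = axis 1 1 \<bullet> (axis 2 1 :: real^2)"
      using T unfolding n_def orthogonal_transformation_def by metis
    then show ?thesis by (simp add: inner_axis_axis)
  qed
  moreover have "surj ?f"
    unfolding surj_def
  proof
    fix y :: "real^2"
    have "surj T" using T(1) by (rule orthogonal_transformation_surj)
    then obtain x where x: "T x = y - p" by (metis surjD)
    have "?e (x $ 1, x $ 2) = x" by (simp add: vec_eq_iff forall_2 axis_def)
    then have "?f (x $ 1, x $ 2) = p + T x" unfolding Te[symmetric] by (rule arg_cong)
    then have "?f (x $ 1, x $ 2) = y" unfolding x by simp
    then show "\<exists>z. y = ?f z" by metis
  qed
  moreover have "distr lborel borel ?f = lborel"
  proof -
    have mT: "T \<in> borel_measurable borel"
      using lin by (intro borel_measurable_continuous_onI linear_continuous_on) (simp add: linear_linear)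
    have me: "?e \<in> borel_measurable lborel"
      by (simp, intro borel_measurable_continuous_onI continuous_intros)
    have "lborel = distr (distr (distr lborel borel ?e) borel T) borel ((+) p)"
      by (simp only: distr_lborel_pair_vec distr_lborel_orthogonal_transformation[OF T(1)] lborel_distr_plus)
    also have "\<dots> = distr lborel borel (((+) p \<circ> T) \<circ> ?e)"
      using mT me by (simp add: distr_distr measurable_comp o_assoc)
    also have "((+) p \<circ> T) \<circ> ?e = ?f" using Te by auto
    finally show ?thesis by simp
  qed
  ultimately show ?thesis using that by blast
qed

section \<open>Solid angle centers\<close>

lemma solid_angle_kernel_continuous:
  fixes x :: "'a::real_normed_vector"
  assumes "0 < h"
  shows "continuous_on S (\<lambda>y. h / (norm (y - x) ^ 2 + h ^ 2) powr (3/2))"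
proof -
  have "0 < norm (y - x) ^ 2 + h ^ 2" for y using assms by (simp add: add_nonneg_pos)
  then have "norm (y - x) ^ 2 + h ^ 2 \<noteq> 0" for y by (metis less_irrefl)
  then show ?thesis by (intro continuous_intros) (simp_all only: powr_eq_0_iff simp_thms ball_triv)
qed

lemma solid_angle_integrable:
  fixes \<Omega> :: "(real^2) set"
  assumes "compact \<Omega>" "0 < h"
  shows "integrable lborel (\<lambda>y. indicator \<Omega> y *\<^sub>R (h / (norm (y - x) ^ 2 + h ^ 2) powr (3/2)))"
  by (rule borel_integrable_compact[OF assms(1) solid_angle_kernel_continuous[OF assms(2)]])

lemma solid_angle_eq_LINT:
  assumes "compact \<Omega>" "0 < h"
  shows "solid_angle \<Omega> h x = (LINT y|lborel. indicator \<Omega> y *\<^sub>R (h / (norm (y - x) ^ 2 + h ^ 2) powr (3/2)))"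
  using set_borel_integral_eq_integral(2)[of \<Omega> "\<lambda>y. h / (norm (y - x) ^ 2 + h ^ 2) powr (3/2)"]
    solid_angle_integrable[OF assms]
  by (simp add: set_integrable_def set_lebesgue_integral_def solid_angle_def)

text \<open>Dominated convergence: the kernel never exceeds its value at distance 0, a constant that
  is integrable over the compact set.\<close>

lemma solid_angle_continuous:
  assumes "compact \<Omega>" "0 < h"
  shows "continuous_on UNIV (solid_angle \<Omega> h)"
proof (rule continuous_on_sequentiallyI)
  fix X :: "nat \<Rightarrow> real^2" and x assume X: "X \<longlonglongrightarrow> x"
  have "0 < norm (y - z) ^ 2 + h ^ 2" for y z :: "real^2"
    using assms by (simp add: add_nonneg_pos)
  then have nz: "norm (y - z) ^ 2 + h ^ 2 \<noteq> 0" for y z :: "real^2" by (metis less_irrefl)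
  show "(\<lambda>n. solid_angle \<Omega> h (X n)) \<longlonglongrightarrow> solid_angle \<Omega> h x"
    unfolding solid_angle_eq_LINT[OF assms]
  proof (rule integral_dominated_convergence)
    show "integrable lborel (\<lambda>y. indicator \<Omega> y *\<^sub>R (h / (h\<^sup>2) powr (3/2)))"
      by (rule borel_integrable_compact[OF assms(1)]) (intro continuous_intros)
    show "AE y in lborel. (\<lambda>n. indicator \<Omega> y *\<^sub>R (h / (norm (y - X n) ^ 2 + h ^ 2) powr (3/2)))
        \<longlonglongrightarrow> indicator \<Omega> y *\<^sub>R (h / (norm (y - x) ^ 2 + h ^ 2) powr (3/2))"
      using nz by (intro AE_I2 tendsto_intros X) (simp_all only: powr_eq_0_iff simp_thms)
    show "AE y in lborel. norm (indicator \<Omega> y *\<^sub>R (h / (norm (y - X n) ^ 2 + h ^ 2) powr (3/2)))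
        \<le> indicator \<Omega> y *\<^sub>R (h / (h\<^sup>2) powr (3/2))" for n
    proof (rule AE_I2)
      fix y
      have "(h\<^sup>2) powr (3/2) \<le> (norm (y - X n) ^ 2 + h ^ 2) powr (3/2)"
        by (intro powr_mono2) auto
      then have "h / (norm (y - X n) ^ 2 + h ^ 2) powr (3/2) \<le> h / (h\<^sup>2) powr (3/2)"
        using assms by (intro divide_left_mono) (auto intro!: mult_pos_pos)
      then show "norm (indicator \<Omega> y *\<^sub>R (h / (norm (y - X n) ^ 2 + h ^ 2) powr (3/2)))
        \<le> indicator \<Omega> y *\<^sub>R (h / (h\<^sup>2) powr (3/2))"
        using assms by (simp add: indicator_def)
    qed
  qed (use solid_angle_integrable[OF assms] in \<open>auto intro: borel_measurable_integrable\<close>)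
qed

text \<open>The plane is not compact, but a maximizer over the body is global: replacing a point by
  its nearest point in the convex body brings it no farther from any point of the body, because the
  projection is nonexpansive and fixes the body. The kernel therefore grows pointwise.\<close>

lemma solid_angle_center_exists:
  assumes "compact \<Omega>" "convex \<Omega>" "\<Omega> \<noteq> {}" "0 < h"
  shows "\<exists>c. solid_angle_center \<Omega> h c"
proof -
  obtain c where c: "c \<in> \<Omega>" "\<And>x. x \<in> \<Omega> \<Longrightarrow> solid_angle \<Omega> h x \<le> solid_angle \<Omega> h c"
    using continuous_attains_sup[OF assms(1,3) continuous_on_subset[OF solid_angle_continuous[OF assms(1,4)]]]
    by auto
  have "solid_angle \<Omega> h x \<le> solid_angle \<Omega> h c" for x
  proof -
    have cl: "closed \<Omega>" using assms by (simp add: compact_imp_closed)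
    define q where "q = closest_point \<Omega> x"
    have "q \<in> \<Omega>" unfolding q_def using cl assms by (intro closest_point_in_set)
    have "solid_angle \<Omega> h x \<le> solid_angle \<Omega> h q"
      unfolding solid_angle_eq_LINT[OF assms(1,4)]
    proof (rule integral_mono[OF solid_angle_integrable solid_angle_integrable, OF assms(1,4) assms(1,4)])
      fix y
      show "indicator \<Omega> y *\<^sub>R (h / (norm (y - x) ^ 2 + h ^ 2) powr (3/2))
          \<le> indicator \<Omega> y *\<^sub>R (h / (norm (y - q) ^ 2 + h ^ 2) powr (3/2))"
      proof (cases "y \<in> \<Omega>")
        case True
        then have "norm (y - q) \<le> norm (y - x)"
          using closest_point_lipschitz[OF assms(2) cl assms(3), of y x] closest_point_self[OF True]
          by (simp add: q_def dist_norm)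
        then have "norm (y - q) ^ 2 + h ^ 2 \<le> norm (y - x) ^ 2 + h ^ 2" by (simp add: power_mono)
        then have "(norm (y - q) ^ 2 + h ^ 2) powr (3/2) \<le> (norm (y - x) ^ 2 + h ^ 2) powr (3/2)"
          by (intro powr_mono2) auto
        moreover have "0 < norm (y - q) ^ 2 + h ^ 2" using assms by (simp add: add_nonneg_pos)
        ultimately show ?thesis using True assms
          by (simp, intro divide_left_mono) (auto intro!: mult_pos_pos)
      qed simp
    qed
    also have "\<dots> \<le> solid_angle \<Omega> h c" using c \<open>q \<in> \<Omega>\<close> by blast
    finally show ?thesis .
  qed
  then show ?thesis by (auto simp: solid_angle_center_def)
qed

lemma solid_angle_frame:
  fixes \<Omega> :: "(real^2) set" and p u n :: "real^2"
  defines "\<phi> \<equiv> \<lambda>z :: real \<times> real. p + (fst z *\<^sub>R u + snd z *\<^sub>R n)"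
  assumes "compact \<Omega>" "0 < h" "norm u = 1" "norm n = 1" "u \<bullet> n = 0"
    and distr: "distr lborel borel \<phi> = lborel"
  shows "solid_angle \<Omega> h (\<phi> (t, \<xi>)) = h * potential (\<phi> -` \<Omega>) h t \<xi>"
proof -
  define g where "g y = indicator \<Omega> y *\<^sub>R (h / (norm (y - \<phi> (t, \<xi>)) ^ 2 + h ^ 2) powr (3/2))" for y
  have un: "u \<bullet> u = 1" "n \<bullet> n = 1" "n \<bullet> u = 0"
    using assms by (simp_all add: norm_eq_1 inner_commute)
  have dist: "norm (\<phi> z - \<phi> (t, \<xi>)) ^ 2 + h ^ 2 = (snd z - \<xi>)\<^sup>2 + ((fst z - t)\<^sup>2 + h\<^sup>2)" for z
  proof -
    have "\<phi> z - \<phi> (t, \<xi>) = (fst z - t) *\<^sub>R u + (snd z - \<xi>) *\<^sub>R n"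
      by (simp add: \<phi>_def algebra_simps)
    then show ?thesis
      unfolding power2_norm_eq_inner
      using un assms(6) by (simp add: inner_add_left inner_add_right power2_eq_square)
  qed
  have "solid_angle \<Omega> h (\<phi> (t, \<xi>)) = (LINT y|distr lborel borel \<phi>. g y)"
    unfolding solid_angle_eq_LINT[OF assms(2,3)] g_def[abs_def] distr by (rule refl)
  also have "\<dots> = (LINT z|lborel. g (\<phi> z))"
  proof (rule integral_distr)
    show "\<phi> \<in> borel_measurable lborel"
      unfolding \<phi>_def by (simp, intro borel_measurable_continuous_onI continuous_intros)
    show "g \<in> borel_measurable borel"
      using borel_measurable_integrable[OF solid_angle_integrable[OF assms(2,3)]] by (simp add: g_def[abs_def])
  qed
  also have "\<dots> = (LINT z|lborel. h * (indicator (\<phi> -` \<Omega>) z *\<^sub>R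
      (1 / ((snd z - \<xi>)\<^sup>2 + ((fst z - t)\<^sup>2 + h\<^sup>2)) powr (3/2))))"
    unfolding g_def dist by (intro Bochner_Integration.integral_cong) (auto simp: indicator_def)
  finally show ?thesis by (simp only: potential_def integral_mult_right_zero)
qed

theorem theorem4p8:
  fixes \<Omega> :: "(real^2) set"
  assumes "convex_body \<Omega>"
    and "piecewise_C1_boundary \<Omega>"
    and "axially_symmetric \<Omega>"
  shows "\<forall>h>0. \<exists>!c. solid_angle_center \<Omega> h c"
proof (intro allI impI)
  fix h :: real assume "0 < h"
  have \<Omega>: "compact \<Omega>" "convex \<Omega>" "interior \<Omega> \<noteq> {}"
    using assms(1) by (auto simp: convex_body_def)
  obtain p u where "norm u = 1" and refl: "line_reflection p u ` \<Omega> = \<Omega>"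
    using assms(3) by (auto simp: axially_symmetric_def)
  obtain n where n: "norm n = 1" "u \<bullet> n = 0"
    and surj: "surj (\<lambda>z. p + (fst z *\<^sub>R u + snd z *\<^sub>R n))"
    and distr: "distr (lborel :: (real \<times> real) measure) borel
      (\<lambda>z. p + (fst z *\<^sub>R u + snd z *\<^sub>R n)) = lborel"
    by (rule axis_frame[OF \<open>norm u = 1\<close>])
  define \<phi> where "\<phi> = (\<lambda>z :: real \<times> real. p + (fst z *\<^sub>R u + snd z *\<^sub>R n))"
  note surj = surj[folded \<phi>_def] and distr = distr[folded \<phi>_def]
  have \<phi>: "\<phi> z = p + (fst z *\<^sub>R u + snd z *\<^sub>R n)" for z by (simp add: \<phi>_def)
  define D where "D = \<phi> -` \<Omega>"
  have un: "u \<bullet> u = 1" "n \<bullet> n = 1" "n \<bullet> u = 0"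
    using n \<open>norm u = 1\<close> by (simp_all add: norm_eq_1 inner_commute)
  have A: "solid_angle \<Omega> h (\<phi> (t, \<xi>)) = h * potential D h t \<xi>" for t \<xi>
    unfolding D_def \<phi>_def
    by (rule solid_angle_frame[OF \<Omega>(1) \<open>0 < h\<close> \<open>norm u = 1\<close> n distr[unfolded \<phi>_def]])
  have cont: "continuous_on UNIV \<phi>" unfolding \<phi>_def by (intro continuous_intros)
  have isom: "dist (\<phi> z) (\<phi> w) = dist z w" for z w
  proof -
    have "\<phi> z - \<phi> w = (fst z - fst w) *\<^sub>R u + (snd z - snd w) *\<^sub>R n"
      by (simp add: \<phi> algebra_simps)
    then have "norm (\<phi> z - \<phi> w) ^ 2 = norm (z - w) ^ 2"
      unfolding power2_norm_eq_inner
      using un n by (simp add: inner_add_left inner_add_right inner_prod_def power2_eq_square)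
    then show ?thesis by (simp add: dist_norm)
  qed
  have "compact D"
  proof -
    have "closed D" unfolding D_def using cont \<Omega>(1) by (simp add: closed_vimage compact_imp_closed)
    moreover have "bounded D"
    proof -
      obtain e where "\<And>y. y \<in> \<Omega> \<Longrightarrow> dist (\<phi> 0) y \<le> e"
        using compact_imp_bounded[OF \<Omega>(1)] bounded_any_center[of \<Omega> "\<phi> 0"] by auto
      then have "\<forall>z\<in>D. dist 0 z \<le> e" unfolding D_def isom[symmetric] by simp
      then show ?thesis unfolding bounded_def by blast
    qed
    ultimately show ?thesis by (simp add: compact_eq_bounded_closed)
  qed
  have "convex D"
  proof (rule convexI)
    fix z w a b assume "z \<in> D" "w \<in> D" and ab: "0 \<le> a" "0 \<le> b" "a + b = (1::real)"
    have "p = a *\<^sub>R p + b *\<^sub>R p" using ab by (metis scaleR_left_distrib scaleR_one)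
    then have "\<phi> (a *\<^sub>R z + b *\<^sub>R w) = a *\<^sub>R \<phi> z + b *\<^sub>R \<phi> w"
      unfolding \<phi> by (simp add: algebra_simps)
    then show "a *\<^sub>R z + b *\<^sub>R w \<in> D"
      using \<open>z \<in> D\<close> \<open>w \<in> D\<close> ab \<Omega>(2) by (simp add: D_def convexD)
  qed
  have "interior D \<noteq> {}"
  proof -
    have "open (\<phi> -` interior \<Omega>)" by (rule open_vimage[OF open_interior cont])
    moreover have "\<phi> -` interior \<Omega> \<subseteq> D" unfolding D_def using interior_subset by blast
    ultimately have "\<phi> -` interior \<Omega> \<subseteq> interior D" by (simp add: interior_maximal)
    moreover have "\<phi> -` interior \<Omega> \<noteq> {}"
      using \<Omega>(3) surj by (metis ex_in_conv surjD vimage_eq)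
    ultimately show ?thesis by blast
  qed
  have symD: "(s, - x) \<in> D" if "(s, x) \<in> D" for s x
  proof -
    \<comment> \<open>In axis coordinates the reflection only changes the sign of the second
      coordinate, because \<open>u\<close> is a unit vector orthogonal to \<open>n\<close>.\<close>
    have "line_reflection p u (\<phi> (s, x)) = \<phi> (s, - x)"
    proof -
      have "(s *\<^sub>R u + x *\<^sub>R n) \<bullet> u = s" using un by (simp add: inner_add_left)
      moreover have "(2 * s) *\<^sub>R u = s *\<^sub>R u + s *\<^sub>R u"
        unfolding mult_2 by (rule scaleR_left_distrib)
      ultimately show ?thesis by (simp add: line_reflection_def \<phi>)
    qed
    moreover have "line_reflection p u (\<phi> (s, x)) \<in> \<Omega>"
      using that refl unfolding D_def by blast
    ultimately show ?thesis by (simp add: D_def)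
  qed
  note off = potential_off_axis[OF \<open>compact D\<close> \<open>convex D\<close> \<open>interior D \<noteq> {}\<close> symD \<open>0 < h\<close>]
  note mid = potential_midpoint[OF \<open>compact D\<close> \<open>convex D\<close> \<open>interior D \<noteq> {}\<close> symD \<open>0 < h\<close>]
  have axis: "\<exists>t. c = \<phi> (t, 0)" if c: "solid_angle_center \<Omega> h c" for c
  proof -
    obtain t \<xi> where eq: "c = \<phi> (t, \<xi>)" using surj by (metis surjD surj_pair)
    \<comment> \<open>The center is compared with the foot of its perpendicular on the axis.\<close>
    have "h * potential D h t 0 \<le> h * potential D h t \<xi>"
      using c unfolding solid_angle_center_def eq A[symmetric] by blast
    then have "\<xi> = 0" using off[of \<xi> t] \<open>0 < h\<close> by force
    then show ?thesis using eq by blast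
  qed
  have "\<Omega> \<noteq> {}" using \<Omega>(3) interior_empty by blast
  then obtain c where c: "solid_angle_center \<Omega> h c"
    using solid_angle_center_exists \<Omega> \<open>0 < h\<close> by blast
  show "\<exists>!c. solid_angle_center \<Omega> h c"
  proof (rule ex1I[where a = c and P = "solid_angle_center \<Omega> h"], rule c)
    fix c' assume c': "solid_angle_center \<Omega> h c'"
    obtain t t' where t: "c = \<phi> (t, 0)" "c' = \<phi> (t', 0)" using axis c c' by blast
    have "h * potential D h r 0 \<le> h * potential D h t 0"
      "h * potential D h r 0 \<le> h * potential D h t' 0" for r
      using c c' unfolding solid_angle_center_def t A[symmetric] by blast+
    then have max: "potential D h r 0 \<le> potential D h t 0"
      "potential D h r 0 \<le> potential D h t' 0" for r
      using \<open>0 < h\<close> by auto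
    then have eq: "potential D h t 0 = potential D h t' 0" by (blast intro: antisym)
    have "t = t'"
    proof (rule ccontr)
      assume "t \<noteq> t'"
      from mid[OF _ this eq] max(1)[of "(t + t') / 2"] show False by simp
    qed
    then show "c' = c" using t by simp
  qed
qed

end
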